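(* Let $\mathcal{P}$ be a convex polytope of dimension $m$ in $\mathbb{R}^n$ all of whose $2$-dimensional faces are centrally symmetric. Then $\mathcal{P}$ is a zonotope (that is, a translate of a set of the form $\mathcal{Z}(\boldsymbol{a}_1,\ldots,\boldsymbol{a}_k)$).
   Context: A set $X\subset\mathbb{R}^n$ is centrally symmetric if there exists $\boldsymbol{c}\in\mathbb{R}^n$ such that $X=2\boldsymbol{c}-X$, where $2\boldsymbol{c}-X=\{2\boldsymbol{c}-\boldsymbol{x}\mid \boldsymbol{x}\in X\}$. For vectors $\boldsymbol{a}_1,\ldots,\boldsymbol{a}_k\in\mathbb{R}^n$, $\mathcal{Z}(\boldsymbol{a}_1,\ldots,\boldsymbol{a}_k)=\{\sum_i t_i\boldsymbol{a}_i\mid 0\leq t_i\leq 1\}$, i.e. the Minkowski sum of the line segments $\{t\boldsymbol{a}_i\mid 0\leq t\leq 1\}$. The polytope $\mathcal{P}$ is regarded as a face of itself. *)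

theory Defs
  imports "HOL-Analysis.Analysis"
begin

definition centrally_symmetric :: "'a::real_vector set \<Rightarrow> bool"
  where "centrally_symmetric X \<longleftrightarrow> (\<exists>c. X = {2 *\<^sub>R c - x | x. x \<in> X})"

text \<open>The list may be empty and may contain repetitions or zero vectors;
  \<open>zonotope_of []\<close> is \<open>{0}\<close>, so single points are zonotopes.\<close>

definition zonotope_of :: "'a::real_vector list \<Rightarrow> 'a set"
  where "zonotope_of as =
    {(\<Sum>i<length as. t i *\<^sub>R as ! i) | t. \<forall>i<length as. 0 \<le> t i \<and> t i \<le> 1}"

definition zonotope :: "'a::real_vector set \<Rightarrow> bool"
  where "zonotope P \<longleftrightarrow> (\<exists>c as. P = (+) c ` zonotope_of as)"

end

theory Submission
  imports Defs
begin

text \<open>The idea is to split off one segment at a time.  Let \<open>[x, x + a]\<close> be an edge of \<open>P\<close>, and project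
  \<open>P\<close> along \<open>a\<close>.  The edge lies over a vertex of the projection \<open>Q\<close> and is the entire fiber there.
  If the fiber over a vertex of \<open>Q\<close> is a translate of \<open>[0, a]\<close>, then so is the fiber over each
  neighbouring vertex, because the part of \<open>P\<close> over an edge of \<open>Q\<close> is then a 2-face and
  its central symmetry exchanges the two fibers (\<open>fiber_transfer_along_edge\<close>).  The edge graph
  of \<open>Q\<close> is connected (\<open>property_spreads_along_edges\<close>), so all vertex fibers are translates of
  \<open>[0, a]\<close>, and by convexity every fiber contains such a translate.  Consequently \<open>P = C + [0, a]\<close>,
  where \<open>C\<close> consists of all \<open>y\<close> such that \<open>y\<close> and \<open>y + a\<close> lie in \<open>P\<close> (\<open>sweep_core\<close>).

  The polytope \<open>C\<close> again satisfies the hypothesis: each nonempty face \<open>G\<close> of it either is a translate of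
  a face of \<open>P\<close> or is parallel to \<open>a\<close> and becomes the face \<open>G + [0, a]\<close> of the same dimension
  (\<open>face_of_sweep_cases\<close>), and central symmetry of \<open>G + [0, a]\<close> implies that of \<open>G\<close>.  Moreover every
  edge of \<open>C\<close> is parallel to an edge of \<open>P\<close>, but none is parallel to \<open>a\<close>
  (\<open>no_parallel_edge_core\<close>).  Thus the number of edge directions drops.  A
  polytope without edges is a point, and summing the removed segments shows that \<open>P\<close> is a zonotope.\<close>

section \<open>Edges of a polytope\<close>

text \<open>This is the connectedness of the edge graph of a polytope, in the form of a property of
  vertices that is passed on along edges.  By induction on the dimension, the vertices of a
  single facet agree about \<open>T\<close>.  If both truth values occurred, the facets would thus fall into two
  classes, and facets of different classes could not meet, since their intersection would have a
  vertex.  The relative frontier would be the union of two disjoint nonempty closed sets, whereas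
  it is connected in every dimension other than 1.\<close>

lemma property_spreads_along_edges:
  fixes Q :: "'a::euclidean_space set"
  assumes "polytope Q" "v extreme_point_of Q" "w extreme_point_of Q" "T v"
    and step: "\<And>x y. \<lbrakk>closed_segment x y face_of Q; x \<noteq> y; T x\<rbrakk> \<Longrightarrow> T y"
  shows "T w"
  using assms
proof (induction "nat (aff_dim Q)" arbitrary: Q v w rule: less_induct)
  case less
  note poly = \<open>polytope Q\<close> and edge_step = less.prems(5)
  have cc: "compact Q" "convex Q"
    using poly by (auto simp: polytope_imp_compact polytope_imp_convex)
  have vw: "v \<in> Q" "w \<in> Q"
    using less.prems(2,3) by (auto simp: extreme_point_of_def)
  show ?case
  proof (cases "aff_dim Q \<le> 1")
    case True
    then obtain x y where Q: "Q = closed_segment x y"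
      using compact_convex_collinear_segment[OF _ cc] vw collinear_aff_dim by blast
    have "closed_segment x y face_of Q" "closed_segment y x face_of Q"
      using Q face_of_refl[OF cc(2)] by (auto simp: closed_segment_commute)
    moreover have "v = x \<or> v = y" "w = x \<or> w = y"
      using less.prems(2,3) unfolding Q by (auto simp: extreme_point_of_segment)
    ultimately show ?thesis
      using edge_step[of x y] edge_step[of y x] less.prems(4) by metis
  next
    case False
    show ?thesis
    proof (rule ccontr)
      assume "\<not> T w"
      define good where "good F \<longleftrightarrow> (\<exists>z. z extreme_point_of F \<and> T z)" for F
      define bad where "bad F \<longleftrightarrow> (\<exists>z. z extreme_point_of F \<and> \<not> T z)" for F
      define A where "A = \<Union>{F. F facet_of Q \<and> good F}"
      define B where "B = \<Union>{F. F facet_of Q \<and> bad F}"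
      have pure: "\<not> (good F \<and> bad F)" if F: "F facet_of Q" for F
      proof
        assume "good F \<and> bad F"
        then obtain y z where yz: "y extreme_point_of F" "T y" "z extreme_point_of F" "\<not> T z"
          unfolding good_def bad_def by blast
        have face: "F face_of Q"
          using F facet_of_imp_face_of by blast
        have "nat (aff_dim F) < nat (aff_dim Q)"
          using F False by (auto simp: facet_of_def)
        then show False
          using less.hyps[of F y z] yz face_of_polytope_polytope[OF poly face]
            edge_step face_of_trans[OF _ face] by blast
      qed
      have facet_at: "\<exists>F. F facet_of Q \<and> z extreme_point_of F" if z: "z extreme_point_of Q" for z
      proof -
        have "{z} face_of Q" using z by (simp add: face_of_singleton)
        moreover have "{z} \<noteq> Q" using False aff_dim_sing[of z] by auto
        ultimately obtain F where "F facet_of Q" "{z} \<subseteq> F"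
          using face_of_polyhedron_subset_facet[OF polytope_imp_polyhedron[OF poly]]
          by (metis insert_not_empty)
        then show ?thesis
          using extreme_point_of_face[OF facet_of_imp_face_of] z by blast
      qed
      have has_vertex: "\<exists>z. z extreme_point_of F" if "F face_of Q" "F \<noteq> {}" for F
        using extreme_point_exists_convex[of F] that face_of_polytope_polytope[OF poly]
          polytope_imp_compact polytope_imp_convex by metis
      have frontier: "rel_frontier Q = \<Union>{F. F facet_of Q}"
        by (rule rel_frontier_of_polyhedron[OF polytope_imp_polyhedron[OF poly]])
      have fin: "finite {F. F facet_of Q}"
        by (rule finite_polytope_facets[OF poly])
      have clF: "closed F" if "F facet_of Q" for F
        using that face_of_polytope_polytope[OF poly] facet_of_imp_face_of polytope_imp_closed by blast
      have "closed A" "closed B"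
        unfolding A_def B_def using clF
        by (auto intro!: closed_Union finite_subset[OF _ fin])
      moreover have "rel_frontier Q \<subseteq> A \<union> B"
      proof
        fix x assume "x \<in> rel_frontier Q"
        then obtain F where F: "F facet_of Q" "x \<in> F" unfolding frontier by blast
        then obtain z where "z extreme_point_of F"
          using has_vertex[of F] by (auto simp: facet_of_def)
        then have "good F \<or> bad F" unfolding good_def bad_def by blast
        then show "x \<in> A \<union> B" using F unfolding A_def B_def by blast
      qed
      moreover have "A \<inter> B \<inter> rel_frontier Q = {}"
      proof (rule ccontr)
        assume "A \<inter> B \<inter> rel_frontier Q \<noteq> {}"
        then obtain x F G where FG: "F facet_of Q" "good F" "G facet_of Q" "bad G" "x \<in> F \<inter> G"
          unfolding A_def B_def by blast
        then have Ff: "F face_of Q" and Gf: "G face_of Q"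
          by (auto simp: facet_of_imp_face_of)
        obtain z where z: "z extreme_point_of F \<inter> G"
          using has_vertex[OF face_of_Int[OF Ff Gf]] FG(5) by blast
        then have "z extreme_point_of Q" "z \<in> F \<inter> G"
          using extreme_point_of_face[OF face_of_Int[OF Ff Gf]] by auto
        then have "z extreme_point_of F" "z extreme_point_of G"
          using extreme_point_of_face Ff Gf by auto
        then show False
          using pure FG unfolding good_def bad_def by blast
      qed
      moreover have "A \<inter> rel_frontier Q \<noteq> {}"
      proof -
        obtain F where "F facet_of Q" "v extreme_point_of F"
          using facet_at less.prems(2) by blast
        then have "v \<in> A \<inter> rel_frontier Q"
          using less.prems(4) unfolding A_def frontier good_def extreme_point_of_def by blast
        then show ?thesis by blast
      qed
      moreover have "B \<inter> rel_frontier Q \<noteq> {}"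
      proof -
        obtain F where "F facet_of Q" "w extreme_point_of F"
          using facet_at less.prems(3) by blast
        then have "w \<in> B \<inter> rel_frontier Q"
          using \<open>\<not> T w\<close> unfolding B_def frontier bad_def extreme_point_of_def by blast
        then show ?thesis by blast
      qed
      ultimately have "\<not> connected (rel_frontier Q)"
        unfolding connected_closed by blast
      moreover have "connected (rel_frontier Q)"
        using path_connected_sphere_gen[OF cc(2)] cc(1) False
        by (auto simp: compact_imp_bounded path_connected_imp_connected)
      ultimately show False by blast
    qed
  qed
qed

text \<open>Pass to facets until the dimension is 1.\<close>

lemma polytope_edge_exists:
  fixes P :: "'a::euclidean_space set"
  assumes "polytope P" "0 < aff_dim P"
  shows "\<exists>x y. x \<noteq> y \<and> closed_segment x y face_of P"
  using assms
proof (induction "nat (aff_dim P)" arbitrary: P rule: less_induct)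
  case less
  note poly = \<open>polytope P\<close>
  show ?case
  proof (cases "aff_dim P = 1")
    case True
    then obtain x y where P: "P = closed_segment x y"
      using compact_convex_collinear_segment[of P] poly collinear_aff_dim[of P] less.prems(2)
        polytope_imp_compact polytope_imp_convex
      by (metis order_refl not_one_less_zero aff_dim_negative_iff)
    then have "x \<noteq> y" using True by auto
    then show ?thesis
      using P face_of_refl[OF polytope_imp_convex[OF poly]] by blast
  next
    case False
    obtain F where F: "F facet_of P"
      using polytope_facet_exists less.prems by blast
    then have "F face_of P" "aff_dim F = aff_dim P - 1"
      by (auto simp: facet_of_def)
    then show ?thesis
      using less.hyps[of F] less.prems False face_of_polytope_polytope face_of_trans
      by (smt (verit, best) nat_less_eq_zless)
  qed
qed

section \<open>Projection along an edge\<close>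

text \<open>The orthogonal projection with kernel spanned by \<open>a\<close>.  Orthogonality yields
  \<open>inner_proj\<close>: functionals that vanish on \<open>a\<close> take the same values before and after projecting,
  so supporting hyperplanes parallel to \<open>a\<close> serve a polytope and its image alike.\<close>

definition proj :: "'a::real_inner \<Rightarrow> 'a \<Rightarrow> 'a"
  where "proj a x = x - ((x \<bullet> a) / (a \<bullet> a)) *\<^sub>R a"

lemma linear_proj: "linear (proj a)"
  unfolding proj_def
  by (intro linearI) (simp_all add: add_divide_distrib algebra_simps)

lemma proj_add: "proj a (x + y) = proj a x + proj a y"
  and proj_diff: "proj a (x - y) = proj a x - proj a y"
  and proj_scaleR: "proj a (c *\<^sub>R x) = c *\<^sub>R proj a x"
  using linear_proj[of a] by (simp_all add: linear_add linear_diff linear_cmul)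

lemma proj_self [simp]: "proj a a = 0"
  by (cases "a = 0") (auto simp: proj_def)

lemma proj_eq_iff: "proj a x = proj a y \<longleftrightarrow> (\<exists>t. y = x + t *\<^sub>R a)"
proof
  assume "proj a x = proj a y"
  then have "y = x + (y \<bullet> a / (a \<bullet> a) - x \<bullet> a / (a \<bullet> a)) *\<^sub>R a"
    by (simp add: proj_def algebra_simps)
  then show "\<exists>t. y = x + t *\<^sub>R a" ..
qed (auto simp: proj_add proj_scaleR)

lemma inner_proj: "u \<bullet> a = 0 \<Longrightarrow> u \<bullet> proj a x = u \<bullet> x"
  by (simp add: proj_def inner_diff_right)

lemma mem_segment_translate: "y \<in> closed_segment x (x + a) \<longleftrightarrow> (\<exists>t. 0 \<le> t \<and> t \<le> 1 \<and> y = x + t *\<^sub>R a)"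
  by (auto simp: in_segment algebra_simps)

lemma polytope_face_exposed:
  fixes P :: "'a::euclidean_space set"
  assumes "polytope P" "F face_of P"
  obtains u b where "P \<subseteq> {x. u \<bullet> x \<le> b}" "F = P \<inter> {x. u \<bullet> x = b}"
  using assms exposed_face_of_polyhedron[OF polytope_imp_polyhedron] exposed_face_of_def by metis

lemma face_of_linear_preimage:
  assumes "linear f" "convex P" "G face_of f ` P"
  shows "{x \<in> P. f x \<in> G} face_of P"
  unfolding face_of_def
proof (intro conjI ballI impI)
  have "convex (P \<inter> f -` G)"
    by (intro convex_Int convex_linear_vimage assms face_of_imp_convex[OF assms(3)])
  moreover have "{x \<in> P. f x \<in> G} = P \<inter> f -` G" by auto
  ultimately show "convex {x \<in> P. f x \<in> G}" by simp
next
  fix p q x assume pq: "p \<in> P" "q \<in> P" and x: "x \<in> {x \<in> P. f x \<in> G}" "x \<in> open_segment p q"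
  obtain t where t: "0 < t" "t < 1" "x = (1 - t) *\<^sub>R p + t *\<^sub>R q"
    using x(2) by (auto simp: in_segment)
  have fx: "f x = (1 - t) *\<^sub>R f p + t *\<^sub>R f q"
    using assms(1) t by (simp add: linear_add linear_cmul)
  have "f p \<in> G \<and> f q \<in> G"
  proof (cases "f p = f q")
    case True
    then show ?thesis using fx x by (auto simp: scaleR_left_distrib[symmetric])
  next
    case False
    then have "f x \<in> open_segment (f p) (f q)"
      using fx t by (auto simp: in_segment)
    then show ?thesis
      using assms(3) face_ofD x(1) pq by blast
  qed
  then show "p \<in> {x \<in> P. f x \<in> G}" "q \<in> {x \<in> P. f x \<in> G}" using pq by auto
qed auto

text \<open>A hyperplane that cuts out an edge parallel to \<open>a\<close> is itself parallel to \<open>a\<close>.  Hence it also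
  supports the projection, and there it cuts out a single point.\<close>

lemma parallel_edge_projects_to_vertex:
  fixes P :: "'a::euclidean_space set"
  assumes "polytope P" "closed_segment x y face_of P" "y = x + s *\<^sub>R a" "s \<noteq> 0"
  shows "proj a x extreme_point_of proj a ` P"
    and "{z \<in> P. proj a z = proj a x} = closed_segment x y"
proof -
  obtain u b where u: "P \<subseteq> {x. u \<bullet> x \<le> b}" "closed_segment x y = P \<inter> {x. u \<bullet> x = b}"
    using polytope_face_exposed assms(1,2) by blast
  have xy: "x \<in> P" "u \<bullet> x = b" "u \<bullet> y = b"
    using u(2) ends_in_segment by blast+
  then have ua: "u \<bullet> a = 0"
    using assms(3,4) by (simp add: inner_add_right)
  have seg: "proj a z = proj a x" if "z \<in> closed_segment x y" for z
    using that assms(3) by (auto simp: in_segment proj_add proj_scaleR algebra_simps)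
  have "proj a ` P \<inter> {z. u \<bullet> z = b} = {proj a x}"
  proof (intro equalityI subsetI)
    fix z assume "z \<in> proj a ` P \<inter> {z. u \<bullet> z = b}"
    then obtain p where "p \<in> P" "z = proj a p" "u \<bullet> p = b"
      using inner_proj[OF ua] by auto
    then show "z \<in> {proj a x}" using seg u(2) by blast
  qed (use xy inner_proj[OF ua] in auto)
  moreover have "convex (proj a ` P)"
    using assms(1) linear_proj polytope_imp_convex convex_linear_image by blast
  then have "(proj a ` P \<inter> {z. u \<bullet> z = b}) face_of proj a ` P"
    using u(1) inner_proj[OF ua] by (intro face_of_Int_supporting_hyperplane_le) auto
  ultimately show "proj a x extreme_point_of proj a ` P"
    by (simp add: face_of_singleton)
  show "{z \<in> P. proj a z = proj a x} = closed_segment x y"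
  proof (intro equalityI subsetI)
    fix z assume "z \<in> {z \<in> P. proj a z = proj a x}"
    then have "z \<in> P" "u \<bullet> z = b"
      using inner_proj[OF ua, of z] inner_proj[OF ua, of x] xy by auto
    then show "z \<in> closed_segment x y" using u(2) by blast
  qed (use seg u in auto)
qed

lemma centrally_symmetricE:
  assumes "centrally_symmetric X"
  obtains c where "\<And>x. 2 *\<^sub>R c - x \<in> X \<longleftrightarrow> x \<in> X"
proof -
  obtain c where c: "X = {2 *\<^sub>R c - x | x. x \<in> X}"
    using assms centrally_symmetric_def by blast
  have *: "2 *\<^sub>R c - x \<in> X" if "x \<in> X" for x
    using that by (subst c) blast
  then have "2 *\<^sub>R c - x \<in> X \<longleftrightarrow> x \<in> X" for x
    using *[of "2 *\<^sub>R c - x"] *[of x] by auto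
  then show thesis using that by blast
qed

lemma centrally_symmetricI:
  assumes "\<And>x. x \<in> X \<Longrightarrow> e - x \<in> X"
  shows "centrally_symmetric X"
  unfolding centrally_symmetric_def
proof (intro exI[of _ "(1/2) *\<^sub>R e"] equalityI subsetI)
  fix x assume "x \<in> X"
  then have "e - x \<in> X" "x = 2 *\<^sub>R ((1/2) *\<^sub>R e) - (e - x)" using assms by auto
  then show "x \<in> {2 *\<^sub>R ((1/2) *\<^sub>R e) - x |x. x \<in> X}" by blast
qed (use assms in auto)

lemma collinear_direction:
  assumes "collinear S" "x \<in> S" "x + a \<in> S" "y \<in> S" "a \<noteq> 0"
  shows "\<exists>t. y = x + t *\<^sub>R a"
proof -
  obtain u c d where "(x + a) - x = c *\<^sub>R u" "y - x = d *\<^sub>R u"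
    using assms unfolding collinear_def by meson
  then have "y = x + (d / c) *\<^sub>R a" using assms(5) by (auto simp: algebra_simps)
  then show ?thesis ..
qed

text \<open>This is where the hypothesis on 2-faces acts.  The part of \<open>P\<close> over an edge of the
  projection is a face; with a segment \<open>[x, x + a]\<close> as fiber over one end, it is 2-dimensional.
  Its central symmetry projects to the reflection of the edge \<open>[v, w]\<close>, which exchanges
  the ends, so the fiber over \<open>w\<close> is the mirror image of the fiber over \<open>v\<close>.\<close>

lemma fiber_transfer_along_edge:
  fixes P :: "'a::euclidean_space set"
  assumes "convex P" "a \<noteq> 0" "closed_segment v w face_of proj a ` P" "v \<noteq> w"
    and sym: "\<And>F. F face_of P \<Longrightarrow> aff_dim F = 2 \<Longrightarrow> centrally_symmetric F"
    and fiber: "{z \<in> P. proj a z = v} = closed_segment x (x + a)"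
  shows "\<exists>y. {z \<in> P. proj a z = w} = closed_segment y (y + a)"
proof -
  define H where "H = {z \<in> P. proj a z \<in> closed_segment v w}"
  have "w \<in> proj a ` P"
    using assms(3) face_of_imp_subset by auto
  then obtain y where y: "y \<in> P" "proj a y = w" by auto
  have x: "x \<in> P" "proj a x = v" "x + a \<in> P"
    using fiber ends_in_segment by blast+
  have pxa: "proj a (x + a) = v" using x by (simp add: proj_add)
  have H3: "x \<in> H" "x + a \<in> H" "y \<in> H"
    using x y pxa by (auto simp: H_def)
  have "H \<subseteq> affine hull {x, x + a, y}"
  proof
    fix h assume "h \<in> H"
    then obtain t where t: "proj a h = (1 - t) *\<^sub>R v + t *\<^sub>R w"
      by (auto simp: H_def in_segment)
    then have "proj a ((1 - t) *\<^sub>R x + t *\<^sub>R y) = proj a h"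
      using x y by (simp add: proj_add proj_scaleR)
    then obtain s where "h = (1 - t) *\<^sub>R x + t *\<^sub>R y + s *\<^sub>R a"
      using proj_eq_iff by blast
    then have "h = (1 - t - s) *\<^sub>R x + s *\<^sub>R (x + a) + t *\<^sub>R y"
      by (simp add: algebra_simps)
    moreover have "(1 - t - s) + s + t = 1" by simp
    ultimately show "h \<in> affine hull {x, x + a, y}"
      unfolding affine_hull_3 by blast
  qed
  then have "aff_dim H \<le> aff_dim {x, x + a, y}"
    by (metis aff_dim_affine_hull aff_dim_subset)
  also have "\<dots> \<le> 2"
    using aff_dim_le_card[of "{x, x + a, y}"] card_insert_le_m1[of 3 "{x + a, y}" x]
      card_insert_le_m1[of 2 "{y}" "x + a"] by simp
  finally have le2: "aff_dim H \<le> 2" .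
  have "\<not> collinear H"
  proof
    assume "collinear H"
    then have "proj a x = proj a y"
      using collinear_direction[OF _ H3 assms(2)] proj_eq_iff by blast
    then show False using x y assms(4) by simp
  qed
  then have "aff_dim H = 2" using le2 collinear_aff_dim[of H] by linarith
  moreover have "H face_of P"
    unfolding H_def by (rule face_of_linear_preimage[OF linear_proj assms(1,3)])
  ultimately obtain c where c: "\<And>z. 2 *\<^sub>R c - z \<in> H \<longleftrightarrow> z \<in> H"
    using sym centrally_symmetricE by metis
  define c' where "c' = 2 *\<^sub>R proj a c"
  have pc: "proj a (2 *\<^sub>R c - z) = c' - proj a z" for z
    by (simp add: c'_def proj_diff proj_scaleR)
  have "c' - v \<in> closed_segment v w" "c' - w \<in> closed_segment v w"
    using c[of x] c[of y] H3 pc[of x] pc[of y] x y by (auto simp: H_def)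
  then obtain s r where sr: "0 \<le> s" "s \<le> 1" "c' - v = (1 - s) *\<^sub>R v + s *\<^sub>R w"
    "0 \<le> r" "r \<le> 1" "c' - w = (1 - r) *\<^sub>R v + r *\<^sub>R w"
    by (auto simp: in_segment)
  \<comment> \<open>A point reflection that maps both ends of a segment into the segment must swap them.\<close>
  have "w - v = (c' - v) - (c' - w)" by simp
  also have "\<dots> = (s - r) *\<^sub>R (w - v)" unfolding sr(3,6) by (simp add: algebra_simps)
  finally have "(s - r - 1) *\<^sub>R (w - v) = 0" by (simp add: algebra_simps)
  then have "s - r = 1" using assms(4) by simp
  then have "s = 1" using sr by linarith
  then have cw: "c' = v + w" using sr by (simp add: algebra_simps)
  have "{z \<in> P. proj a z = w} = closed_segment (2 *\<^sub>R c - x - a) (2 *\<^sub>R c - x - a + a)"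
  proof (intro set_eqI)
    fix z
    have "z \<in> {z \<in> P. proj a z = w} \<longleftrightarrow> z \<in> H \<and> proj a z = w" by (auto simp: H_def)
    also have "\<dots> \<longleftrightarrow> 2 *\<^sub>R c - z \<in> H \<and> proj a (2 *\<^sub>R c - z) = v"
      using c pc[of z] cw by (auto simp: algebra_simps)
    also have "\<dots> \<longleftrightarrow> 2 *\<^sub>R c - z \<in> {z \<in> P. proj a z = v}" by (auto simp: H_def)
    also have "\<dots> \<longleftrightarrow> (\<exists>t. 0 \<le> t \<and> t \<le> 1 \<and> 2 *\<^sub>R c - z = x + t *\<^sub>R a)"
      unfolding fiber mem_segment_translate ..
    also have "\<dots> \<longleftrightarrow> (\<exists>t. 0 \<le> t \<and> t \<le> 1 \<and> z = 2 *\<^sub>R c - x - a + t *\<^sub>R a)"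
    proof
      assume "\<exists>t. 0 \<le> t \<and> t \<le> 1 \<and> 2 *\<^sub>R c - z = x + t *\<^sub>R a"
      then obtain t where "0 \<le> t" "t \<le> 1" "2 *\<^sub>R c - z = x + t *\<^sub>R a" by blast
      then show "\<exists>t. 0 \<le> t \<and> t \<le> 1 \<and> z = 2 *\<^sub>R c - x - a + t *\<^sub>R a"
        by (intro exI[of _ "1 - t"]) (simp add: algebra_simps)
    next
      assume "\<exists>t. 0 \<le> t \<and> t \<le> 1 \<and> z = 2 *\<^sub>R c - x - a + t *\<^sub>R a"
      then obtain t where "0 \<le> t" "t \<le> 1" "z = 2 *\<^sub>R c - x - a + t *\<^sub>R a" by blast
      then show "\<exists>t. 0 \<le> t \<and> t \<le> 1 \<and> 2 *\<^sub>R c - z = x + t *\<^sub>R a"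
        by (intro exI[of _ "1 - t"]) (simp add: algebra_simps)
    qed
    also have "\<dots> \<longleftrightarrow> z \<in> closed_segment (2 *\<^sub>R c - x - a) (2 *\<^sub>R c - x - a + a)"
      unfolding mem_segment_translate ..
    finally show "z \<in> {z \<in> P. proj a z = w} \<longleftrightarrow>
      z \<in> closed_segment (2 *\<^sub>R c - x - a) (2 *\<^sub>R c - x - a + a)" .
  qed
  then show ?thesis by blast
qed

section \<open>Splitting off a segment\<close>

text \<open>The Minkowski sum of \<open>S\<close> and the segment \<open>[0, a]\<close>.\<close>

definition sweep :: "'a::real_vector \<Rightarrow> 'a set \<Rightarrow> 'a set"
  where "sweep a S = {x + t *\<^sub>R a | x t. x \<in> S \<and> 0 \<le> t \<and> t \<le> 1}"

text \<open>For convex \<open>P\<close> this is the Minkowski difference of \<open>P\<close> and the segment \<open>[0, a]\<close>: the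
  largest set whose sum with the segment lies in \<open>P\<close>.\<close>

definition core :: "'a::real_vector \<Rightarrow> 'a set \<Rightarrow> 'a set"
  where "core a P = {x \<in> P. x + a \<in> P}"

lemma sweepI: "\<lbrakk>x \<in> S; 0 \<le> t; t \<le> 1\<rbrakk> \<Longrightarrow> x + t *\<^sub>R a \<in> sweep a S"
  unfolding sweep_def by blast

lemma sweepE:
  assumes "y \<in> sweep a S"
  obtains x t where "x \<in> S" "0 \<le> t" "t \<le> 1" "y = x + t *\<^sub>R a"
  using assms unfolding sweep_def by blast

lemma subset_sweep: "S \<subseteq> sweep a S"
  using sweepI[of _ S 0 a] by fastforce

lemma polytope_core:
  fixes P :: "'a::euclidean_space set"
  assumes "polytope P"
  shows "polytope (core a P)"
proof -
  have "core a P = P \<inter> (+) (- a) ` P"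
    unfolding core_def by (force simp: image_iff algebra_simps)
  then show ?thesis using assms by (metis polytope_Int polytope_translation_eq)
qed

text \<open>The edge \<open>[x, x + a]\<close> of \<open>P\<close> is the fiber over one vertex of the projection, and having a
  translate of \<open>[0, a]\<close> as fiber spreads along the edges of the projection.\<close>

lemma vertex_fiber:
  fixes P :: "'a::euclidean_space set"
  assumes "polytope P" "a \<noteq> 0" "closed_segment x (x + a) face_of P"
    and sym: "\<And>F. F face_of P \<Longrightarrow> aff_dim F = 2 \<Longrightarrow> centrally_symmetric F"
    and w: "w extreme_point_of proj a ` P"
  shows "\<exists>y. {z \<in> P. proj a z = w} = closed_segment y (y + a)"
proof (rule property_spreads_along_edges[where Q = "proj a ` P" and v = "proj a x"
      and T = "\<lambda>w. \<exists>y. {z \<in> P. proj a z = w} = closed_segment y (y + a)"])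
  show "polytope (proj a ` P)"
    using assms(1) linear_proj polytope_linear_image by blast
  show "proj a x extreme_point_of proj a ` P"
    and "\<exists>y. {z \<in> P. proj a z = proj a x} = closed_segment y (y + a)"
    using parallel_edge_projects_to_vertex[OF assms(1,3), of 1 a] by auto
  fix v w
  assume "closed_segment v w face_of proj a ` P" "v \<noteq> w"
    "\<exists>y. {z \<in> P. proj a z = v} = closed_segment y (y + a)"
  then show "\<exists>y. {z \<in> P. proj a z = w} = closed_segment y (y + a)"
    using fiber_transfer_along_edge[OF polytope_imp_convex[OF assms(1)] assms(2) _ _ sym] by blast
qed (rule w)

text \<open>The image of the core is convex and contains all vertices of \<open>proj a ` P\<close>.  In other words,
  fibers that have length at least \<open>norm a\<close> over the vertices have it everywhere.\<close>

lemma proj_core: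
  fixes P :: "'a::euclidean_space set"
  assumes "polytope P"
    and fibers: "\<And>w. w extreme_point_of proj a ` P \<Longrightarrow>
      \<exists>y. {z \<in> P. proj a z = w} = closed_segment y (y + a)"
  shows "proj a ` core a P = proj a ` P"
proof
  have Q: "polytope (proj a ` P)" and C: "polytope (proj a ` core a P)"
    using assms(1) linear_proj polytope_core polytope_linear_image by blast+
  have "{w. w extreme_point_of proj a ` P} \<subseteq> proj a ` core a P"
  proof
    fix w assume "w \<in> {w. w extreme_point_of proj a ` P}"
    then obtain y where y: "{z \<in> P. proj a z = w} = closed_segment y (y + a)"
      using fibers by blast
    then have "y \<in> core a P" "proj a y = w"
      using ends_in_segment[of y "y + a"] by (auto simp: core_def)
    then show "w \<in> proj a ` core a P" by blast
  qed
  then have "convex hull {w. w extreme_point_of proj a ` P} \<subseteq> proj a ` core a P"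
    using polytope_imp_convex[OF C] by (rule hull_minimal)
  then show "proj a ` P \<subseteq> proj a ` core a P"
    using Krein_Milman_Minkowski Q polytope_imp_compact polytope_imp_convex by metis
qed (auto simp: core_def)

text \<open>If every line parallel to \<open>a\<close> that meets \<open>P\<close> contains a segment \<open>[x, x + a]\<close> inside \<open>P\<close>,
  then by convexity this translate of \<open>[0, a]\<close> can be slid within \<open>P\<close> along the line until it
  covers a given point of \<open>P\<close>.\<close>

lemma sweep_core:
  fixes P :: "'a::real_inner set"
  assumes "convex P" "proj a ` core a P = proj a ` P"
  shows "sweep a (core a P) = P"
proof
  have between: "x + t *\<^sub>R a \<in> P" if "x + r *\<^sub>R a \<in> P" "x + s *\<^sub>R a \<in> P" "r \<le> t" "t \<le> s" for x r s t
  proof (cases "r = s")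
    case False
    then have "r < s" using that by linarith
    define l where "l = (t - r) / (s - r)"
    have l: "0 \<le> l" "l \<le> 1" "(1 - l) * r + l * s = t"
      using \<open>r < s\<close> that by (auto simp: l_def divide_simps) (simp add: algebra_simps)
    have "(1 - l) *\<^sub>R (x + r *\<^sub>R a) + l *\<^sub>R (x + s *\<^sub>R a) = x + ((1 - l) * r + l * s) *\<^sub>R a"
      by (simp add: algebra_simps)
    then show ?thesis
      using convexD[OF assms(1) that(1,2), of "1 - l" l] l by simp
  qed (use that in auto)
  show "sweep a (core a P) \<subseteq> P"
  proof
    fix y assume "y \<in> sweep a (core a P)"
    then show "y \<in> P"
      using between[of _ 0 1] by (elim sweepE) (auto simp: core_def)
  qed
  show "P \<subseteq> sweep a (core a P)"
  proof
    fix y assume y: "y \<in> P"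
    then obtain x where x: "x \<in> core a P" "proj a x = proj a y"
      using assms(2) by (metis imageE imageI)
    then obtain t where t: "y = x + t *\<^sub>R a" using proj_eq_iff by blast
    have xa: "x + 0 *\<^sub>R a \<in> P" "x + 1 *\<^sub>R a \<in> P" using x by (auto simp: core_def)
    consider "t < 0" | "0 \<le> t" "t \<le> 1" | "1 < t" by linarith
    then show "y \<in> sweep a (core a P)"
    proof cases
      case 1
      have "y + a = x + (t + 1) *\<^sub>R a" by (simp add: t algebra_simps)
      moreover have "x + (t + 1) *\<^sub>R a \<in> P" using between[OF _ xa(2), of t "t + 1"] 1 t y by simp
      ultimately have "y \<in> core a P" using y by (simp add: core_def)
      then show ?thesis using subset_sweep by blast
    next
      case 2
      then show ?thesis unfolding t by (intro sweepI x)
    next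
      case 3
      have ya: "y - a = x + (t - 1) *\<^sub>R a" by (simp add: t algebra_simps)
      have "x + (t - 1) *\<^sub>R a \<in> P" using between[OF xa(1), of t "t - 1"] 3 t y by simp
      then have "y - a \<in> P" unfolding ya .
      then have "y - a \<in> core a P" using y by (simp add: core_def)
      then show ?thesis using sweepI[of "y - a" "core a P" 1 a] by simp
    qed
  qed
qed

text \<open>An edge of the core parallel to \<open>a\<close> would lie over a vertex of the projection, but there
  the fiber of \<open>P\<close> is only a translate of \<open>[0, a]\<close>, so the core has just one point.\<close>

lemma no_parallel_edge_core:
  fixes P :: "'a::euclidean_space set"
  assumes "polytope P" "a \<noteq> 0"
    and fibers: "\<And>w. w extreme_point_of proj a ` P \<Longrightarrow>
      \<exists>y. {z \<in> P. proj a z = w} = closed_segment y (y + a)"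
    and edge: "closed_segment x (x + s *\<^sub>R a) face_of core a P"
  shows "s = 0"
proof (rule ccontr)
  assume s: "s \<noteq> 0"
  have "proj a x extreme_point_of proj a ` P"
    using parallel_edge_projects_to_vertex(1)[OF polytope_core[OF assms(1)] edge refl s]
      proj_core[OF assms(1) fibers] by simp
  then obtain y where y: "{z \<in> P. proj a z = proj a x} = closed_segment y (y + a)"
    using fibers by blast
  have core_y: "z = y" if z: "z \<in> core a P" "proj a z = proj a x" for z
  proof -
    have "z \<in> closed_segment y (y + a)" "z + a \<in> closed_segment y (y + a)"
      using z by (auto simp: y[symmetric] core_def proj_add)
    then obtain t r where "t \<ge> 0" "z = y + t *\<^sub>R a" "r \<le> 1" "z + a = y + r *\<^sub>R a"
      unfolding mem_segment_translate by blast
    moreover from this have "(r - t - 1) *\<^sub>R a = 0" by (simp add: algebra_simps)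
    ultimately show ?thesis using assms(2) by auto
  qed
  have "x \<in> core a P" "x + s *\<^sub>R a \<in> core a P"
    using face_of_imp_subset[OF edge] ends_in_segment by blast+
  then have "x = y" "x + s *\<^sub>R a = y"
    by (auto intro!: core_y simp: proj_add proj_scaleR simp del: add_cancel_left_right)
  then show False using s assms(2) by simp
qed

section \<open>Faces of the sum with a segment\<close>

text \<open>When \<open>a\<close> is not parallel to the affine hull of \<open>G\<close>, the sum is a prism with base \<open>G\<close>.\<close>

lemma face_of_sweep_if_transversal:
  fixes G :: "'a::real_vector set"
  assumes "convex G" and transversal: "\<And>g. g \<in> G \<Longrightarrow> g + a \<notin> affine hull G"
  shows "G face_of sweep a G"
  unfolding face_of_def
proof (intro conjI ballI impI)
  fix p q x assume pq: "p \<in> sweep a G" "q \<in> sweep a G" and x: "x \<in> G" "x \<in> open_segment p q"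
  obtain g s h t where gh: "g \<in> G" "0 \<le> s" "p = g + s *\<^sub>R a" "h \<in> G" "0 \<le> t" "q = h + t *\<^sub>R a"
    using pq by (metis sweepE)
  obtain l where l: "0 < l" "l < 1" "x = (1 - l) *\<^sub>R p + l *\<^sub>R q"
    using x(2) by (auto simp: in_segment)
  define k where "k = (1 - l) *\<^sub>R g + l *\<^sub>R h"
  define m where "m = (1 - l) * s + l * t"
  have k: "k \<in> G" using assms(1) gh l by (simp add: k_def convexD_alt)
  have xk: "x = k + m *\<^sub>R a" by (simp add: l gh k_def m_def algebra_simps)
  have "m = 0"
  proof (rule ccontr)
    assume "m \<noteq> 0"
    then have "k + a = (1 - 1 / m) *\<^sub>R k + (1 / m) *\<^sub>R x"
      by (simp add: xk algebra_simps)
    also have "\<dots> \<in> affine hull G"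
      using k x hull_subset[of G affine] mem_affine[OF affine_affine_hull] by (metis diff_add_cancel subsetD)
    finally show False using transversal k by blast
  qed
  then have "(1 - l) * s = 0 \<and> l * t = 0"
    using l gh by (simp add: m_def add_nonneg_eq_0_iff)
  then have "s = 0" "t = 0" using l by auto
  then show "p \<in> G" "q \<in> G" using gh by auto
qed (use assms subset_sweep in auto)

lemma aff_dim_sweep_if_parallel:
  fixes G :: "'a::euclidean_space set"
  assumes "g \<in> G" "g + a \<in> affine hull G"
  shows "aff_dim (sweep a G) = aff_dim G"
proof (rule antisym)
  have "sweep a G \<subseteq> affine hull G"
  proof
    fix y assume "y \<in> sweep a G"
    then obtain x t where "x \<in> G" "y = x + t *\<^sub>R ((g + a) - g)" by (metis add_diff_cancel_left' sweepE)
    then show "y \<in> affine hull G"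
      using mem_affine_3_minus[OF affine_affine_hull, of x G "g + a" g t] assms hull_inc[of _ G affine]
      by simp
  qed
  then show "aff_dim (sweep a G) \<le> aff_dim G"
    by (metis aff_dim_affine_hull aff_dim_subset)
qed (simp add: aff_dim_subset subset_sweep)

text \<open>Let \<open>u\<close> be a functional whose maximum on \<open>C\<close> is attained on \<open>G\<close>.  On the sum with
  \<open>[0, a]\<close> it is maximal on \<open>G\<close>, on \<open>a + G\<close> or on the whole of \<open>sweep a G\<close>, according to the sign of
  its value at \<open>a\<close>.  In the last case \<open>G\<close> is either the base of a prism, hence again a
  face, or parallel to \<open>a\<close>.  So the 2-faces and edges of the summand can be read off from
  those of the sum.\<close>

lemma face_of_sweep_cases:
  fixes C :: "'a::euclidean_space set"
  assumes "polytope C" "convex (sweep a C)" "G face_of C" "G \<noteq> {}"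
  shows "(\<exists>c. (+) c ` G face_of sweep a C) \<or> (sweep a G face_of sweep a C \<and> aff_dim (sweep a G) = aff_dim G)"
proof -
  obtain u b where u: "C \<subseteq> {x. u \<bullet> x \<le> b}" "G = C \<inter> {x. u \<bullet> x = b}"
    using polytope_face_exposed assms(1,3) by blast
  have supp: "sweep a C \<inter> {x. u \<bullet> x = d} face_of sweep a C" if "\<And>x t. x \<in> C \<Longrightarrow> 0 \<le> t \<Longrightarrow> t \<le> 1 \<Longrightarrow> u \<bullet> x + t * (u \<bullet> a) \<le> d" for d
    using that by (intro face_of_Int_supporting_hyperplane_le assms(2)) (auto elim!: sweepE simp: inner_add_right)
  consider "u \<bullet> a < 0" | "u \<bullet> a = 0" | "u \<bullet> a > 0" by linarith
  then show ?thesis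
  proof cases
    case 1
    have "sweep a C \<inter> {x. u \<bullet> x = b} = (+) 0 ` G"
    proof (intro equalityI subsetI)
      fix y assume "y \<in> sweep a C \<inter> {x. u \<bullet> x = b}"
      then obtain x t where x: "x \<in> C" "0 \<le> t" "y = x + t *\<^sub>R a" "u \<bullet> x + t * (u \<bullet> a) = b"
        by (auto elim!: sweepE simp: inner_add_right)
      then have "t * (u \<bullet> a) \<ge> 0" using u(1) by auto
      then have "t = 0" using 1 x(2) by (simp add: zero_le_mult_iff)
      then show "y \<in> (+) 0 ` G" using x u by simp
    qed (use u subset_sweep in auto)
    moreover have "u \<bullet> x + t * (u \<bullet> a) \<le> b" if "x \<in> C" "0 \<le> t" for x t
      using u(1) that 1 mult_nonneg_nonpos[of t "u \<bullet> a"] by fastforce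
    ultimately show ?thesis using supp[of b] by metis
  next
    case 2
    have "sweep a C \<inter> {x. u \<bullet> x = b} = sweep a G"
    proof (intro equalityI subsetI)
      fix y assume "y \<in> sweep a C \<inter> {x. u \<bullet> x = b}"
      then obtain x t where "x \<in> C" "0 \<le> t" "t \<le> 1" "y = x + t *\<^sub>R a" "u \<bullet> y = b"
        by (auto elim: sweepE)
      then show "y \<in> sweep a G" using u(2) 2 by (auto simp: inner_add_right intro!: sweepI)
    qed (use u 2 in \<open>auto elim!: sweepE simp: inner_add_right intro!: sweepI\<close>)
    then have face: "sweep a G face_of sweep a C"
      using supp[of b] u(1) 2 by auto
    show ?thesis
    proof (cases "\<exists>g\<in>G. g + a \<in> affine hull G")
      case True
      then show ?thesis using face aff_dim_sweep_if_parallel by blast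
    next
      case False
      then have "G face_of sweep a G"
        using face_of_sweep_if_transversal face_of_imp_convex[OF assms(3)] by blast
      then have "(+) 0 ` G face_of sweep a C" using face face_of_trans by auto
      then show ?thesis by blast
    qed
  next
    case 3
    have "sweep a C \<inter> {x. u \<bullet> x = b + u \<bullet> a} = (+) a ` G"
    proof (intro equalityI subsetI)
      fix y assume "y \<in> sweep a C \<inter> {x. u \<bullet> x = b + u \<bullet> a}"
      then obtain x t where x: "x \<in> C" "t \<le> 1" "y = x + t *\<^sub>R a" "u \<bullet> x + t * (u \<bullet> a) = b + u \<bullet> a"
        by (auto elim!: sweepE simp: inner_add_right)
      then have "(1 - t) * (u \<bullet> a) \<le> 0" using u(1) by (auto simp: algebra_simps)
      then have "t = 1" using 3 x(2) by (simp add: mult_le_0_iff)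
      then show "y \<in> (+) a ` G" using x u by simp
    next
      fix y assume "y \<in> (+) a ` G"
      then show "y \<in> sweep a C \<inter> {x. u \<bullet> x = b + u \<bullet> a}"
        using u sweepI[of _ C 1 a] by (auto simp: inner_add_right add.commute)
    qed
    moreover have "u \<bullet> x + t * (u \<bullet> a) \<le> b + u \<bullet> a" if "x \<in> C" "t \<le> 1" for x t
      using u(1) that 3 mult_right_mono[of t 1 "u \<bullet> a"] by (intro add_mono) auto
    ultimately show ?thesis using supp[of "b + u \<bullet> a"] by metis
  qed
qed

text \<open>A set \<open>G\<close> that is convex contains every \<open>y\<close> such that \<open>y\<close> and \<open>y + a\<close> both lie in
  \<open>sweep a G\<close>: then \<open>y\<close> lies between two points \<open>g\<close>, \<open>h\<close> of \<open>G\<close> on a line parallel to \<open>a\<close>.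
  If \<open>x\<close> belongs to \<open>G\<close>, reflecting \<open>x\<close> and \<open>x + a\<close> yields such a pair.\<close>

lemma centrally_symmetric_sweep_cancel:
  fixes G :: "'a::real_vector set"
  assumes "convex G" "centrally_symmetric (sweep a G)"
  shows "centrally_symmetric G"
proof -
  obtain c where c: "\<And>x. 2 *\<^sub>R c - x \<in> sweep a G \<longleftrightarrow> x \<in> sweep a G"
    using centrally_symmetricE[OF assms(2)] by blast
  show ?thesis
  proof (rule centrally_symmetricI[where e = "2 *\<^sub>R c - a"])
    fix x assume x: "x \<in> G"
    define y where "y = 2 *\<^sub>R c - a - x"
    have "x \<in> sweep a G" "x + a \<in> sweep a G"
      using sweepI[OF x, of 0] sweepI[OF x, of 1] by auto
    then have "y + a \<in> sweep a G" "y \<in> sweep a G"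
      using c[of x] c[of "x + a"] by (auto simp: y_def algebra_simps)
    then obtain g s h t where g: "g \<in> G" "0 \<le> s" "y = g + s *\<^sub>R a"
      and h: "h \<in> G" "t \<le> 1" "y + a = h + t *\<^sub>R a"
      by (metis sweepE)
    have h': "h = y + (1 - t) *\<^sub>R a" using h(3) by (simp add: algebra_simps)
    have "y \<in> G"
    proof (cases "s = 0")
      case False
      \<comment> \<open>Since \<open>y - g = s a\<close> and \<open>h - y = (1 - t) a\<close>, the point \<open>y\<close> divides \<open>[g, h]\<close> in the
        ratio \<open>s : (1 - t)\<close>.\<close>
      define d where "d = s + (1 - t)"
      have d: "d > 0" using False g(2) h(2) by (simp add: d_def)
      have "((1 - t) / d) *\<^sub>R g + (s / d) *\<^sub>R h
          = ((1 - t) / d + s / d) *\<^sub>R g + ((s / d) * (s + (1 - t))) *\<^sub>R a"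
        unfolding h' g(3) by (simp add: scaleR_add_right scaleR_add_left distrib_left)
      also have "(1 - t) / d + s / d = 1" using d by (simp add: d_def add_divide_distrib[symmetric])
      also have "(s / d) * (s + (1 - t)) = s" using d by (simp add: d_def)
      finally have "((1 - t) / d) *\<^sub>R g + (s / d) *\<^sub>R h = y" by (simp add: g(3))
      moreover have "((1 - t) / d) *\<^sub>R g + (s / d) *\<^sub>R h \<in> G"
        using g h d by (intro convexD[OF assms(1)]) (auto simp: add_divide_distrib[symmetric] d_def)
      ultimately show ?thesis by simp
    qed (use g in simp)
    then show "2 *\<^sub>R c - a - x \<in> G" by (simp add: y_def)
  qed
qed

lemma centrally_symmetric_translation:
  fixes G :: "'a::real_vector set"
  assumes "centrally_symmetric ((+) c ` G)"
  shows "centrally_symmetric G"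
proof -
  obtain d where d: "\<And>x. 2 *\<^sub>R d - x \<in> (+) c ` G \<longleftrightarrow> x \<in> (+) c ` G"
    using centrally_symmetricE[OF assms] by blast
  show ?thesis
  proof (rule centrally_symmetricI[where e = "2 *\<^sub>R d - 2 *\<^sub>R c"])
    fix x assume "x \<in> G"
    then have "2 *\<^sub>R d - (c + x) \<in> (+) c ` G" using d by blast
    then obtain g where "g \<in> G" "2 *\<^sub>R d - (c + x) = c + g" by auto
    moreover from this have "2 *\<^sub>R d - 2 *\<^sub>R c - x = g" by (simp add: algebra_simps scaleR_2)
    ultimately show "2 *\<^sub>R d - 2 *\<^sub>R c - x \<in> G" by simp
  qed
qed

section \<open>Zonotopes from edge directions\<close>

lemma zonotope_of_snoc: "zonotope_of (as @ [a]) = sweep a (zonotope_of as)"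
proof (intro equalityI subsetI)
  fix y assume "y \<in> zonotope_of (as @ [a])"
  then obtain t where t: "\<And>i. i < Suc (length as) \<Longrightarrow> 0 \<le> t i \<and> t i \<le> 1"
    "y = (\<Sum>i<Suc (length as). t i *\<^sub>R (as @ [a]) ! i)"
    unfolding zonotope_of_def by auto
  then have "y = (\<Sum>i<length as. t i *\<^sub>R as ! i) + t (length as) *\<^sub>R a"
    by (simp add: nth_append)
  moreover have "(\<Sum>i<length as. t i *\<^sub>R as ! i) \<in> zonotope_of as"
    unfolding zonotope_of_def using t(1) less_SucI by blast
  ultimately show "y \<in> sweep a (zonotope_of as)"
    using t(1)[of "length as"] by (simp add: sweepI)
next
  fix y assume "y \<in> sweep a (zonotope_of as)"
  then obtain x s where s: "x \<in> zonotope_of as" "0 \<le> s" "s \<le> 1" "y = x + s *\<^sub>R a"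
    by (rule sweepE)
  then obtain t where t: "\<And>i. i < length as \<Longrightarrow> 0 \<le> t i \<and> t i \<le> 1" "x = (\<Sum>i<length as. t i *\<^sub>R as ! i)"
    unfolding zonotope_of_def by auto
  define t' where "t' = t(length as := s)"
  have "y = (\<Sum>i<length (as @ [a]). t' i *\<^sub>R (as @ [a]) ! i)"
    by (simp add: s(4) t(2) t'_def nth_append)
  moreover have "\<forall>i<length (as @ [a]). 0 \<le> t' i \<and> t' i \<le> 1"
    using t(1) s by (auto simp: t'_def less_Suc_eq)
  ultimately show "y \<in> zonotope_of (as @ [a])"
    unfolding zonotope_of_def by blast
qed

lemma zonotope_sweep:
  assumes "zonotope P"
  shows "zonotope (sweep a P)"
proof -
  obtain c as where "P = (+) c ` zonotope_of as" using assms zonotope_def by blast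
  then have "sweep a P = (+) c ` zonotope_of (as @ [a])"
    unfolding zonotope_of_snoc by (force simp: sweep_def image_iff add.assoc)
  then show ?thesis unfolding zonotope_def by blast
qed

lemma zonotope_singleton: "zonotope {p}"
  unfolding zonotope_def zonotope_of_def by (intro exI[of _ p] exI[of _ "[]"]) auto

text \<open>The set \<open>D\<close> is the induction parameter: if some edge \<open>a\<close> is parallel to no element of \<open>D\<close>
  other than \<open>d\<close>, splitting off \<open>[0, a]\<close> removes the direction of \<open>d\<close> and creates no new one.\<close>

lemma zonotope_if_edges_parallel_to_finite:
  fixes P :: "'a::euclidean_space set"
  assumes "finite D" "polytope P" "P \<noteq> {}"
    and "\<And>F. F face_of P \<Longrightarrow> aff_dim F = 2 \<Longrightarrow> centrally_symmetric F"
    and "\<And>x y. closed_segment x y face_of P \<Longrightarrow> x \<noteq> y \<Longrightarrow> \<exists>d\<in>D. \<exists>r. y - x = r *\<^sub>R d"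
  shows "zonotope P"
  using assms
proof (induction D arbitrary: P)
  case empty
  have "\<not> 0 < aff_dim P"
    using polytope_edge_exists[OF empty.prems(1)] empty.prems(4) by blast
  then have "aff_dim P = 0" using empty.prems(2) aff_dim_geq[of P] aff_dim_empty[of P] by linarith
  then show ?case using zonotope_singleton by (auto simp: aff_dim_eq_0)
next
  case (insert d D)
  note poly = \<open>polytope P\<close> and sym = insert.prems(3) and dirs = insert.prems(4)
  show ?case
  proof (cases "\<forall>x y. closed_segment x y face_of P \<longrightarrow> x \<noteq> y \<longrightarrow> (\<exists>d\<in>D. \<exists>r. y - x = r *\<^sub>R d)")
    case True
    then show ?thesis using insert.IH[OF poly] insert.prems by blast
  next
    case False
    then obtain x y where xy: "closed_segment x y face_of P" "x \<noteq> y"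
      and notD: "\<not> (\<exists>e\<in>D. \<exists>r. y - x = r *\<^sub>R e)" by blast
    then obtain r where r: "y - x = r *\<^sub>R d" using dirs[OF xy] by blast
    define a where "a = y - x"
    define C where "C = core a P"
    have a: "a \<noteq> 0" "closed_segment x (x + a) face_of P" using xy by (auto simp: a_def)
    have fibers: "\<exists>y. {z \<in> P. proj a z = w} = closed_segment y (y + a)"
      if "w extreme_point_of proj a ` P" for w
      using vertex_fiber[OF poly a sym that] .
    have projC: "proj a ` C = proj a ` P"
      unfolding C_def by (rule proj_core[OF poly fibers])
    have P: "sweep a C = P"
      using sweep_core[OF polytope_imp_convex[OF poly]] projC unfolding C_def by blast
    have polyC: "polytope C" unfolding C_def by (rule polytope_core[OF poly])
    have no_parallel: "q \<noteq> p + s *\<^sub>R a" if "closed_segment p q face_of C" "p \<noteq> q" for p q s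
      using no_parallel_edge_core[OF poly a(1) fibers, of p s] that unfolding C_def by auto
    have faces: "(\<exists>c. (+) c ` G face_of P) \<or> (sweep a G face_of P \<and> aff_dim (sweep a G) = aff_dim G)"
      if "G face_of C" "G \<noteq> {}" for G
      using face_of_sweep_cases[OF polyC _ that, of a] polytope_imp_convex[OF poly] unfolding P by blast
    have "zonotope C"
    proof (rule insert.IH[OF polyC])
      show "C \<noteq> {}" using projC insert.prems(2) by auto
    next
      fix G assume G: "G face_of C" "aff_dim G = 2"
      then have "G \<noteq> {}" "convex G" by (auto simp: face_of_imp_convex)
      then show "centrally_symmetric G"
        using faces[OF G(1)] sym G(2) aff_dim_translation_eq[of _ G]
          centrally_symmetric_translation centrally_symmetric_sweep_cancel by metis
    next
      fix p q assume pq: "closed_segment p q face_of C" "p \<noteq> q"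
      \<comment> \<open>Otherwise the edge would be parallel to \<open>a\<close>.\<close>
      have "\<not> aff_dim (sweep a (closed_segment p q)) = aff_dim (closed_segment p q)"
      proof
        assume "aff_dim (sweep a (closed_segment p q)) = aff_dim (closed_segment p q)"
        then have "collinear (sweep a (closed_segment p q))"
          unfolding collinear_aff_dim by (metis collinear_aff_dim collinear_closed_segment)
        moreover have "p \<in> sweep a (closed_segment p q)" "q \<in> sweep a (closed_segment p q)"
          "p + a \<in> sweep a (closed_segment p q)"
          using subset_sweep[of "closed_segment p q" a] sweepI[of p "closed_segment p q" 1 a] by auto
        ultimately show False
          using collinear_direction a(1) no_parallel[OF pq] by blast
      qed
      then obtain c where "(+) c ` closed_segment p q face_of P"
        using faces[OF pq(1)] by auto
      then have "closed_segment (c + p) (c + q) face_of P"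
        by (simp add: closed_segment_translation)
      then obtain e k where e: "e \<in> insert d D" "(c + q) - (c + p) = k *\<^sub>R e"
        using dirs[of "c + p" "c + q"] pq(2) by auto
      have "e \<noteq> d"
      proof
        assume "e = d"
        then have "q = p + (k / r) *\<^sub>R a"
          using e(2) r a(1) by (auto simp: a_def algebra_simps)
        then show False using no_parallel[OF pq] by blast
      qed
      then show "\<exists>e\<in>D. \<exists>k. q - p = k *\<^sub>R e" using e by auto
    qed
    then show ?thesis using zonotope_sweep P by metis
  qed
qed

theorem proposition1p6:
  fixes P :: "(real ^ 'n) set" and m :: nat
  assumes "polytope P"
    and "aff_dim P = int m"
    and "\<And>F. F face_of P \<Longrightarrow> aff_dim F = 2 \<Longrightarrow> centrally_symmetric F"
  shows "zonotope P"
proof (rule zonotope_if_edges_parallel_to_finite)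
  \<comment> \<open>The ends of an edge are vertices, so finitely many differences give all edge directions.\<close>
  define V where "V = {v. v extreme_point_of P}"
  have "finite V"
    unfolding V_def using assms(1) finite_polyhedron_extreme_points polytope_imp_polyhedron by blast
  then show "finite ((\<lambda>(v, w). w - v) ` (V \<times> V))" by simp
  show "P \<noteq> {}" using assms(2) by auto
  fix x y assume face: "closed_segment x y face_of P"
  have "x \<in> V" "y \<in> V"
    using extreme_point_of_face[OF face] unfolding V_def by (auto simp: extreme_point_of_segment)
  then have "y - x \<in> (\<lambda>(v, w). w - v) ` (V \<times> V)" by force
  moreover have "y - x = 1 *\<^sub>R (y - x)" by simp
  ultimately show "\<exists>d\<in>(\<lambda>(v, w). w - v) ` (V \<times> V). \<exists>r. y - x = r *\<^sub>R d" by blast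
qed (use assms in auto)

end
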